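(* Let $\nabla_1>0$ be an integer. There exists a distributed algorithm in the LOCAL model which, on every input graph $G$ with $\nabla_1(G)\le \nabla_1$, runs in a constant number of rounds and outputs a dominating set of $G$ of size $\mathcal{O}(\gamma(G))$; that is, there are constants $r$ and $c$ depending only on $\nabla_1$ such that the algorithm terminates after at most $r$ communication rounds and outputs a dominating set $D'$ with $|D'|\le c\cdot\gamma(G)$.
   Context: All graphs are finite, undirected and simple. In the LOCAL model the input graph is the communication network: each vertex is a processor with a unique identifier, initially knowing nothing about the graph; in each synchronous round every vertex may send arbitrary messages to its neighbours and perform arbitrary local computation; at the end each vertex decides whether it belongs to the output set. A dominating set of $G$ is a set $D\subseteq V(G)$ such that every vertex is in $D$ or has a neighbour in $D$; $\gamma(G)$ is the minimum size of a dominating set. A graph $H$ is a $1$-shallow minor of $G$ if $H$ can be obtained from $G$ by deleting vertices and edges and then contracting pairwise vertex-disjoint connected subgraphs of radius at most $1$ (i.e. stars) to single vertices. $\nabla_1(G)$ denotes the maximum of $|E(H)|/|V(H)|$ over all $1$-shallow minors $H$ of $G$. *)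

theory Defs
  imports Complex_Main
begin

text \<open>Finite simple graphs: vertex set V (a finite set of naturals; a vertex's
  natural number is its unique identifier) and a symmetric irreflexive edge
  relation E living on V.\<close>

definition graph :: "nat set \<Rightarrow> (nat \<Rightarrow> nat \<Rightarrow> bool) \<Rightarrow> bool" where
  "graph V E \<longleftrightarrow> finite V \<and> (\<forall>x y. E x y \<longrightarrow> x \<in> V \<and> y \<in> V \<and> x \<noteq> y \<and> E y x)"

definition dominating :: "nat set \<Rightarrow> (nat \<Rightarrow> nat \<Rightarrow> bool) \<Rightarrow> nat set \<Rightarrow> bool" where
  "dominating V E D \<longleftrightarrow> D \<subseteq> V \<and> (\<forall>v\<in>V. v \<in> D \<or> (\<exists>u\<in>D. E v u))"

definition domination_number :: "nat set \<Rightarrow> (nat \<Rightarrow> nat \<Rightarrow> bool) \<Rightarrow> nat" where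
  "domination_number V E = Min (card ` {D. dominating V E D})"

text \<open>A 1-shallow minor H of G, given by its model: the vertex set of H is a
  finite family P of pairwise disjoint branch sets, each inducing a star
  (a centre c adjacent to all other members) in G; the edge set F of H is a
  set of unordered pairs of distinct branch sets joined by an edge of G.\<close>

definition star_set :: "nat set \<Rightarrow> (nat \<Rightarrow> nat \<Rightarrow> bool) \<Rightarrow> nat set \<Rightarrow> bool" where
  "star_set V E B \<longleftrightarrow> B \<subseteq> V \<and> (\<exists>c\<in>B. \<forall>x\<in>B. x = c \<or> E c x)"

definition shallow1_minor ::
  "nat set \<Rightarrow> (nat \<Rightarrow> nat \<Rightarrow> bool) \<Rightarrow> nat set set \<Rightarrow> nat set set set \<Rightarrow> bool" where
  "shallow1_minor V E P F \<longleftrightarrow>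
     finite P \<and> (\<forall>B\<in>P. star_set V E B) \<and>
     (\<forall>B\<in>P. \<forall>B'\<in>P. B \<noteq> B' \<longrightarrow> B \<inter> B' = {}) \<and>
     (\<forall>e\<in>F. \<exists>B B'. e = {B, B'} \<and> B \<in> P \<and> B' \<in> P \<and> B \<noteq> B' \<and>
              (\<exists>x\<in>B. \<exists>y\<in>B'. E x y))"

definition nabla1_le :: "nat set \<Rightarrow> (nat \<Rightarrow> nat \<Rightarrow> bool) \<Rightarrow> nat \<Rightarrow> bool" where
  "nabla1_le V E d \<longleftrightarrow>
     (\<forall>P F. shallow1_minor V E P F \<and> P \<noteq> {} \<longrightarrow>
        real (card F) / real (card P) \<le> real d)"

text \<open>LOCAL model.  A deterministic algorithm is given by an initial state
  depending only on the vertex identifier, a message function (the message a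
  vertex sends to its neighbours, computed from its state), and a transition
  function mapping the current state and the set of messages received from
  the neighbours to the new state.  local_state gives the state of v after
  t synchronous rounds.\<close>

primrec local_state ::
  "(nat \<Rightarrow> 's) \<Rightarrow> ('s \<Rightarrow> 'm) \<Rightarrow> ('s \<Rightarrow> 'm set \<Rightarrow> 's) \<Rightarrow>
   nat set \<Rightarrow> (nat \<Rightarrow> nat \<Rightarrow> bool) \<Rightarrow> nat \<Rightarrow> nat \<Rightarrow> 's" where
  "local_state init msg step V E 0 v = init v"
| "local_state init msg step V E (Suc t) v =
     step (local_state init msg step V E t v)
           ((\<lambda>u. msg (local_state init msg step V E t u)) ` {u \<in> V. E v u})"

definition local_output ::
  "(nat \<Rightarrow> 's) \<Rightarrow> ('s \<Rightarrow> 'm) \<Rightarrow> ('s \<Rightarrow> 'm set \<Rightarrow> 's) \<Rightarrow> ('s \<Rightarrow> bool) \<Rightarrow> nat \<Rightarrow>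
   nat set \<Rightarrow> (nat \<Rightarrow> nat \<Rightarrow> bool) \<Rightarrow> nat set" where
  "local_output init msg step out r V E = {v \<in> V. out (local_state init msg step V E r v)}"

end

theory Submission
  imports Defs "HOL-Library.Nat_Bijection"
begin

text \<open>
  Let \<open>D\<close> be a minimum dominating set. Contracting the stars around the vertices of \<open>D\<close> shows that
  all but \<open>2d |D|\<close> vertices outside \<open>D\<close> have a closed neighbourhood covered by at most \<open>2d + 1\<close>
  vertices of \<open>D\<close>; call the exceptional ones scattered.

  Every vertex \<open>x\<close> has a locally computable candidate set of bounded size such that, for \<open>x\<close>
  neither in \<open>D\<close> nor scattered, every large subset of its closed neighbourhood is covered in a
  constant fraction by some candidate in \<open>D\<close>. A chain is a sequence of distinct vertices, each a
  candidate of its predecessor. As \<open>G\<close> has no large complete bipartite subgraphs, no chain with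
  \<open>2d + 1\<close> vertices has many common neighbours. For the lengths \<open>2d, 2d - 1, \<dots>, 1\<close> in turn,
  select the last vertices of all chains of that length with many common undominated neighbours.
  After each stage no such chain of that length remains, so at the next stage no chain can be
  prolonged; hence each of them contains a vertex that is in \<open>D\<close> or scattered, and its last
  vertex is reached from that one in boundedly many candidate steps. This bounds the number of
  selected vertices by \<open>O(|D|)\<close>. In the end every vertex has boundedly many undominated
  neighbours, so that all undominated vertices can be selected. Whether a vertex is selected
  depends only on its surroundings up to distance \<open>4d + 3\<close>, which it learns by flooding.
\<close>

lemma card_UN_le_mult:
  assumes "finite I" and "\<And>i. i \<in> I \<Longrightarrow> card (A i) \<le> k"
  shows "card (\<Union>i\<in>I. A i) \<le> card I * k"
  using card_UN_le[OF assms(1), of A] sum_bounded_above[of I "\<lambda>i. card (A i)" k] assms(2)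
  by simp

section \<open>Closed neighbourhoods and domination\<close>

definition cnbh :: "('a \<Rightarrow> 'a \<Rightarrow> bool) \<Rightarrow> 'a \<Rightarrow> 'a set" where
  "cnbh E v = insert v {u. E v u}"

definition common_cnbh :: "('a \<Rightarrow> 'a \<Rightarrow> bool) \<Rightarrow> 'a set \<Rightarrow> 'a set" where
  "common_cnbh E X = (\<Inter>p\<in>X. cnbh E p)"

lemma self_mem_cnbh [simp]: "v \<in> cnbh E v"
  by (simp add: cnbh_def)

lemma cnbh_commute: "symp E \<Longrightarrow> u \<in> cnbh E v \<longleftrightarrow> v \<in> cnbh E u"
  by (auto simp: cnbh_def dest: sympD)

lemma common_cnbh_insert: "common_cnbh E (insert p X) = cnbh E p \<inter> common_cnbh E X"
  by (simp add: common_cnbh_def)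

lemma common_cnbh_subset: "p \<in> X \<Longrightarrow> common_cnbh E X \<subseteq> cnbh E p"
  by (auto simp: common_cnbh_def)

locale fin_graph =
  fixes V :: "nat set" and E :: "nat \<Rightarrow> nat \<Rightarrow> bool"
  assumes is_graph: "graph V E"
begin

lemma finite_subset_V: "X \<subseteq> V \<Longrightarrow> finite X"
  using is_graph finite_subset unfolding graph_def by blast

lemma symp_E: "symp E"
  using is_graph by (auto simp: graph_def symp_def)

lemma adjD: "E x y \<Longrightarrow> x \<in> V \<and> y \<in> V \<and> x \<noteq> y"
  using is_graph by (auto simp: graph_def)

lemma cnbh_subset: "v \<in> V \<Longrightarrow> cnbh E v \<subseteq> V"
  by (auto simp: cnbh_def dest: adjD)

lemma cnbh_outside: "v \<notin> V \<Longrightarrow> cnbh E v = {v}"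
  by (auto simp: cnbh_def dest: adjD)

lemma finite_cnbh: "finite (cnbh E v)"
  by (cases "v \<in> V") (simp_all add: finite_subset_V cnbh_subset cnbh_outside)

lemma finite_dominating: "dominating V E D \<Longrightarrow> finite D"
  by (simp add: dominating_def finite_subset_V)

lemma domination_number_attained:
  obtains D where "dominating V E D" "card D = domination_number V E"
proof -
  have "{D. dominating V E D} \<subseteq> Pow V" by (auto simp: dominating_def)
  then have "finite {D. dominating V E D}"
    using finite_subset_V[of V] by (simp add: finite_subset)
  moreover have "dominating V E V" by (simp add: dominating_def)
  ultimately have "domination_number V E \<in> card ` {D. dominating V E D}"
    unfolding domination_number_def by (intro Min_in) auto
  then show ?thesis using that by auto
qed

lemma card_le_by_domination:
  assumes dominates: "dominating V E D" and few: "\<And>u. u \<in> D \<Longrightarrow> card (U \<inter> cnbh E u) \<le> t"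
  shows "card (V \<inter> U) \<le> card D * t"
proof -
  have "V \<inter> U \<subseteq> (\<Union>u\<in>D. U \<inter> cnbh E u)"
    using dominates symp_E unfolding dominating_def cnbh_def by (fastforce dest: sympD)
  then have "card (V \<inter> U) \<le> card (\<Union>u\<in>D. U \<inter> cnbh E u)"
    using finite_dominating[OF dominates] finite_cnbh by (intro card_mono) auto
  also have "\<dots> \<le> card D * t"
    using finite_dominating[OF dominates] few by (rule card_UN_le_mult)
  finally show ?thesis .
qed

end

section \<open>Contracting stars\<close>

definition star_contraction :: "nat set \<Rightarrow> (nat \<Rightarrow> nat \<Rightarrow> bool) \<Rightarrow> (nat \<Rightarrow> nat) \<Rightarrow> bool" where
  "star_contraction V E c \<longleftrightarrow> (\<forall>w\<in>V. c w \<in> V \<and> w \<in> cnbh E (c w) \<and> c (c w) = c w)"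

definition contracted_arcs :: "('a \<Rightarrow> 'a \<Rightarrow> bool) \<Rightarrow> ('a \<Rightarrow> 'b) \<Rightarrow> ('b \<times> 'b) set" where
  "contracted_arcs E c = {(c x, c y) | x y. E x y \<and> c x \<noteq> c y}"

lemma star_contraction_id: "star_contraction V E id"
  by (simp add: star_contraction_def)

lemma star_contraction_fixes_centre: "star_contraction V E c \<Longrightarrow> p \<in> c ` V \<Longrightarrow> c p = p"
  by (auto simp: star_contraction_def)

lemma star_contraction_override_id:
  "star_contraction V E c \<Longrightarrow> star_contraction V E (override_on c id S)"
  by (auto simp: star_contraction_def override_on_def)

lemma image_override_id:
  assumes contraction: "star_contraction V E c" and "S \<subseteq> V"
  shows "override_on c id S ` V = c ` V \<union> S"
proof (intro equalityI subsetI)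
  show "p \<in> c ` V \<union> S" if "p \<in> override_on c id S ` V" for p
    using that by (auto simp: override_on_def)
next
  fix p assume centre: "p \<in> c ` V \<union> S"
  have "p \<in> V" using centre contraction \<open>S \<subseteq> V\<close> by (auto simp: star_contraction_def)
  moreover have "override_on c id S p = p"
    using centre star_contraction_fixes_centre[OF contraction, of p] by (cases "p \<in> S") simp_all
  ultimately show "p \<in> override_on c id S ` V" by (metis image_eqI)
qed

lemma card_arcs_le_twice_edges:
  assumes "finite A"
  shows "card A \<le> 2 * card ((\<lambda>(p, q). {p, q}) ` A)"
proof -
  let ?F = "(\<lambda>(p, q). {p, q}) ` A" and ?arcs = "\<lambda>e. {(p, q). {p, q} = e}"
  have arcs: "?arcs {p, q} = {(p, q), (q, p)}" for p q :: 'a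
    by (auto simp: doubleton_eq_iff)
  have "card (?arcs e) \<le> 2" if "e \<in> ?F" for e
  proof -
    from that obtain p q where "e = {p, q}" by auto
    then show ?thesis by (simp add: arcs card_insert_le_m1)
  qed
  then have "card (\<Union>e\<in>?F. ?arcs e) \<le> card ?F * 2"
    using assms by (intro card_UN_le_mult) simp_all
  moreover have "card A \<le> card (\<Union>e\<in>?F. ?arcs e)"
    using assms by (intro card_mono) (auto simp: arcs)
  ultimately show ?thesis by simp
qed

context fin_graph
begin

lemma shallow1_minor_contraction:
  fixes c :: "nat \<Rightarrow> nat"
  defines "B \<equiv> \<lambda>p. {w \<in> V. c w = p}"
  assumes contraction: "star_contraction V E c" and centres: "I \<subseteq> c ` V"
  shows "shallow1_minor V E (B ` I) ((\<lambda>(p, q). {B p, B q}) ` (contracted_arcs E c \<inter> I \<times> I))"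
  unfolding shallow1_minor_def
proof (intro conjI ballI impI)
  have "finite I" using centres finite_subset_V[of V] by (simp add: finite_subset)
  then show "finite (B ` I)" by simp
  show "star_set V E b" if "b \<in> B ` I" for b
    using that contraction centres
    unfolding star_set_def star_contraction_def B_def cnbh_def by fastforce
  show "b \<inter> b' = {}" if "b \<in> B ` I" "b' \<in> B ` I" "b \<noteq> b'" for b b'
    using that unfolding B_def by auto
  fix e assume "e \<in> (\<lambda>(p, q). {B p, B q}) ` (contracted_arcs E c \<inter> I \<times> I)"
  then obtain x y where arc: "E x y" "c x \<noteq> c y" "c x \<in> I" "c y \<in> I" "e = {B (c x), B (c y)}"
    by (auto simp: contracted_arcs_def)
  moreover have "x \<in> B (c x)" "y \<in> B (c y)" "x \<notin> B (c y)"
    using adjD[OF arc(1)] arc(2) by (simp_all add: B_def)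
  ultimately show "\<exists>b b'. e = {b, b'} \<and> b \<in> B ` I \<and> b' \<in> B ` I \<and> b \<noteq> b' \<and> (\<exists>x\<in>b. \<exists>y\<in>b'. E x y)"
    by blast
qed

lemma arcs_from_override_id:
  assumes contraction: "star_contraction V E c" and S_noncentres: "S \<subseteq> V" "S \<inter> c ` V = {}"
  defines "r \<equiv> override_on c id S"
  shows "(SIGMA v:S. r ` {w. E v w}) \<subseteq> contracted_arcs E r \<inter> (c ` V \<union> S) \<times> (c ` V \<union> S)"
proof clarify
  fix v w assume v_in_S: "v \<in> S" and adj: "E v w"
  have w_adj: "w \<in> V" "v \<noteq> w" using adjD[OF adj] by simp_all
  have r_fixes_v: "r v = v" using v_in_S by (simp add: r_def)
  have "r v \<noteq> r w"
  proof (cases "w \<in> S")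
    case True
    then show ?thesis using r_fixes_v w_adj(2) by (simp add: r_def)
  next
    case False
    then have "r w \<in> c ` V" using w_adj(1) by (simp add: r_def)
    then show ?thesis using r_fixes_v v_in_S S_noncentres(2) by auto
  qed
  then have "(r v, r w) \<in> contracted_arcs E r" using adj unfolding contracted_arcs_def by blast
  moreover have "r w \<in> c ` V \<union> S"
    using image_override_id[OF contraction S_noncentres(1)] w_adj(1) unfolding r_def by blast
  ultimately show "(v, r w) \<in> contracted_arcs E r \<inter> (c ` V \<union> S) \<times> (c ` V \<union> S)"
    using r_fixes_v v_in_S by simp
qed

lemma dominating_imp_star_contraction:
  assumes "dominating V E D"
  obtains f where "star_contraction V E f" "f ` V = D"
proof -
  have D_subset: "D \<subseteq> V" using assms by (simp add: dominating_def)
  have "\<exists>u\<in>D. w \<in> cnbh E u \<and> (w \<in> D \<longrightarrow> u = w)" if "w \<in> V" for w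
    using assms that symp_E unfolding dominating_def cnbh_def
    by (metis insertI1 insertI2 mem_Collect_eq sympD)
  then obtain f where dominator: "\<And>w. w \<in> V \<Longrightarrow> f w \<in> D \<and> w \<in> cnbh E (f w) \<and> (w \<in> D \<longrightarrow> f w = w)"
    by metis
  have "star_contraction V E f"
    unfolding star_contraction_def using dominator D_subset by blast
  moreover have "f ` V = D" using dominator D_subset by force
  ultimately show ?thesis by (rule that)
qed

end

locale nabla1_graph = fin_graph +
  fixes d :: nat
  assumes nabla1: "nabla1_le V E d"
begin

lemma card_contracted_arcs_le:
  assumes contraction: "star_contraction V E c" and centres: "I \<subseteq> c ` V"
  shows "card (contracted_arcs E c \<inter> I \<times> I) \<le> 2 * d * card I"
proof (cases "I = {}")
  case False
  define B where "B = (\<lambda>p. {w \<in> V. c w = p})"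
  let ?A = "contracted_arcs E c \<inter> I \<times> I"
  let ?F = "(\<lambda>(p, q). {B p, B q}) ` ?A"
  have finite_I: "finite I" using centres finite_subset_V[of V] by (simp add: finite_subset)
  have inj: "inj_on B I" using centres unfolding B_def by (intro inj_onI) blast
  have "?F = (`) B ` (\<lambda>(p, q). {p, q}) ` ?A" by (auto simp: image_image split_def)
  moreover have "inj_on ((`) B) ((\<lambda>(p, q). {p, q}) ` ?A)"
    by (rule inj_on_subset[OF inj_on_image_Pow[OF inj]]) auto
  ultimately have card_edges: "card ?F = card ((\<lambda>(p, q). {p, q}) ` ?A)" by (simp add: card_image)
  have "shallow1_minor V E (B ` I) ?F"
    unfolding B_def by (rule shallow1_minor_contraction[OF contraction centres])
  then have "real (card ?F) / real (card (B ` I)) \<le> real d"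
    using nabla1 False unfolding nabla1_le_def by blast
  moreover have "0 < card I" using False finite_I by (simp add: card_gt_0_iff)
  ultimately have "real (card ?F) \<le> real (d * card I)"
    by (simp add: card_image[OF inj] divide_le_eq)
  then have "card ?F \<le> d * card I" by (simp only: of_nat_le_iff)
  moreover have "card ?A \<le> 2 * card ?F"
    unfolding card_edges using finite_I by (intro card_arcs_le_twice_edges) simp
  ultimately show ?thesis by simp
qed simp

lemma sum_card_cnbh_le:
  assumes Z_subset: "Z \<subseteq> V" and Y_subset: "Y \<subseteq> V"
  shows "(\<Sum>z\<in>Z. card (cnbh E z \<inter> Y)) \<le> (2 * d + 1) * card Z + 2 * d * card Y"
proof -
  have finite_ZY: "finite Z" "finite Y" using assms by (simp_all add: finite_subset_V)
  have arcs: "(SIGMA z:Z. {y \<in> Y. E z y}) \<subseteq> contracted_arcs E id \<inter> (Z \<union> Y) \<times> (Z \<union> Y)"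
    by (auto simp: contracted_arcs_def dest: adjD)
  have "(\<Sum>z\<in>Z. card {y \<in> Y. E z y}) = card (SIGMA z:Z. {y \<in> Y. E z y})" using finite_ZY by simp
  also have "\<dots> \<le> card (contracted_arcs E id \<inter> (Z \<union> Y) \<times> (Z \<union> Y))"
    using arcs by (rule card_mono[rotated]) (simp add: finite_ZY)
  also have "\<dots> \<le> 2 * d * card (Z \<union> Y)"
    using assms by (intro card_contracted_arcs_le star_contraction_id) simp
  also have "\<dots> \<le> 2 * d * (card Z + card Y)"
    by (intro mult_left_mono card_Un_le) simp
  finally have open_nbh: "(\<Sum>z\<in>Z. card {y \<in> Y. E z y}) \<le> 2 * d * (card Z + card Y)" .
  have "card (cnbh E z \<inter> Y) \<le> 1 + card {y \<in> Y. E z y}" for z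
  proof -
    have "card (cnbh E z \<inter> Y) \<le> card (insert z {y \<in> Y. E z y})"
      using finite_ZY by (intro card_mono) (auto simp: cnbh_def)
    also have "\<dots> \<le> 1 + card {y \<in> Y. E z y}" by (rule card_insert_le_m1) simp_all
    finally show ?thesis .
  qed
  then have "(\<Sum>z\<in>Z. card (cnbh E z \<inter> Y)) \<le> (\<Sum>z\<in>Z. 1 + card {y \<in> Y. E z y})"
    by (intro sum_mono)
  also have "\<dots> = card Z + (\<Sum>z\<in>Z. card {y \<in> Y. E z y})"
    by (simp only: sum.distrib card_eq_sum)
  finally show ?thesis using open_nbh by (simp add: algebra_simps)
qed

lemma card_common_cnbh_le:
  assumes many: "2 * d < card X"
  shows "card (common_cnbh E X) \<le> (2 * d + 1) * card X"
proof (cases "X \<subseteq> V")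
  case True
  let ?C = "common_cnbh E X"
  obtain x where x_in_X: "x \<in> X" using many by fastforce
  have common_subset: "?C \<subseteq> V"
    using common_cnbh_subset[OF x_in_X] cnbh_subset[OF subsetD[OF True x_in_X]]
    by (rule subset_trans)
  have "cnbh E p \<inter> ?C = ?C" if "p \<in> X" for p
    using common_cnbh_subset[OF that] by blast
  then have "card X * card ?C = (\<Sum>p\<in>X. card (cnbh E p \<inter> ?C))" by simp
  also have "\<dots> \<le> (2 * d + 1) * card X + 2 * d * card ?C"
    by (rule sum_card_cnbh_le[OF True common_subset])
  finally have "card X * card ?C \<le> (2 * d + 1) * card X + 2 * d * card ?C" .
  moreover have "(2 * d + 1) * card ?C \<le> card X * card ?C"
    using many by (intro mult_right_mono) simp_all
  ultimately show ?thesis by simp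
next
  case False
  then obtain p where "p \<in> X" "p \<notin> V" by blast
  then have "card (common_cnbh E X) \<le> 1"
    using card_mono[OF finite_cnbh common_cnbh_subset[of p X E]] cnbh_outside by simp
  also have "\<dots> \<le> (2 * d + 1) * card X" using many by simp
  finally show ?thesis .
qed

end

section \<open>Scattered vertices\<close>

definition scattered :: "nat set \<Rightarrow> (nat \<Rightarrow> nat \<Rightarrow> bool) \<Rightarrow> nat \<Rightarrow> nat set \<Rightarrow> nat set" where
  "scattered V E k D = {v \<in> V - D. \<not> (\<exists>D'\<subseteq>D. card D' \<le> k \<and> cnbh E v \<subseteq> (\<Union>u\<in>D'. cnbh E u))}"

context fin_graph
begin

lemma scattered_contracted_degree:
  assumes contraction: "star_contraction V E f" "f ` V = D" and v_scattered: "v \<in> scattered V E k D"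
  shows "k \<le> card (override_on f id S ` {w. E v w})"
proof -
  let ?N = "override_on f id S ` {w. E v w}"
  have nbh_subset: "cnbh E v \<subseteq> V" using v_scattered by (intro cnbh_subset) (simp add: scattered_def)
  then have "f ` cnbh E v \<subseteq> D" using contraction(2) by blast
  moreover have "w \<in> cnbh E (f w)" if "w \<in> V" for w
    using contraction(1) that by (simp add: star_contraction_def)
  then have "cnbh E v \<subseteq> (\<Union>u\<in>f ` cnbh E v. cnbh E u)" using nbh_subset by blast
  ultimately have uncoverable: "\<not> card (f ` cnbh E v) \<le> k"
    using v_scattered unfolding scattered_def by blast
  have finite_N: "finite ?N"
    using finite_cnbh[of v] by (simp add: cnbh_def)
  have "f w = f (override_on f id S w)" if "E v w" for w
    using contraction(1) adjD[OF that] by (simp add: star_contraction_def override_on_def)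
  then have "f ` cnbh E v \<subseteq> insert (f v) (f ` ?N)"
    unfolding cnbh_def by blast
  then have "card (f ` cnbh E v) \<le> card (insert (f v) (f ` ?N))"
    using finite_N by (intro card_mono) simp_all
  also have "\<dots> \<le> Suc (card ?N)"
    using card_image_le[OF finite_N, of f] by (intro card_insert_le_m1) simp_all
  finally show ?thesis using uncoverable by simp
qed

end

context nabla1_graph
begin

lemma card_scattered_le:
  assumes dominates: "dominating V E D"
  shows "k * card (scattered V E k D) \<le> 2 * d * (card D + card (scattered V E k D))"
proof -
  obtain f where contraction: "star_contraction V E f" and centres: "f ` V = D"
    by (rule dominating_imp_star_contraction[OF dominates])
  define S where "S = scattered V E k D"
  define r where "r = override_on f id S"
  let ?arcs = "contracted_arcs E r \<inter> (D \<union> S) \<times> (D \<union> S)"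
  have S_outside_D: "S \<subseteq> V" "S \<inter> D = {}" by (auto simp: S_def scattered_def)
  then have finite: "finite S" "finite (D \<union> S)"
    using finite_dominating[OF dominates] by (simp_all add: finite_subset_V)
  have "k * card S = (\<Sum>v\<in>S. k)" by simp
  also have "\<dots> \<le> (\<Sum>v\<in>S. card (r ` {w. E v w}))"
    unfolding r_def S_def by (intro sum_mono scattered_contracted_degree[OF contraction centres])
  also have "\<dots> = card (SIGMA v:S. r ` {w. E v w})"
    using finite finite_cnbh by (simp add: cnbh_def)
  also have "\<dots> \<le> card ?arcs"
    using arcs_from_override_id[OF contraction S_outside_D(1)] S_outside_D(2) finite
    unfolding r_def centres
    by (intro card_mono) simp_all
  also have "\<dots> \<le> 2 * d * card (D \<union> S)"
    using contraction S_outside_D(1) unfolding r_def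
    by (intro card_contracted_arcs_le star_contraction_override_id)
      (simp_all add: image_override_id centres)
  also have "\<dots> \<le> 2 * d * (card D + card S)" by (intro mult_left_mono card_Un_le) simp
  finally show ?thesis by (simp only: S_def)
qed

lemma card_Un_scattered_le:
  assumes "dominating V E D"
  shows "card (D \<union> scattered V E (2 * d + 1) D) \<le> (2 * d + 1) * card D"
  using card_scattered_le[OF assms, of "2 * d + 1"] card_Un_le[of D "scattered V E (2 * d + 1) D"]
  by (simp add: algebra_simps)

end

section \<open>Greedy covers\<close>

definition heavy :: "('a \<Rightarrow> 'a \<Rightarrow> bool) \<Rightarrow> nat \<Rightarrow> 'a set \<Rightarrow> 'a set" where
  "heavy E K Y = {w. card Y \<le> K * card (cnbh E w \<inter> Y)}"

text \<open>All vertices that a greedy cover of \<open>Y\<close> by \<open>k\<close> closed neighbourhoods may use before fewer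
  than \<open>m\<close> vertices are left, where every choice covers a fraction \<open>1/K\<close> of the rest.
  Stopping early is what keeps the number of candidates bounded.\<close>

primrec greedy_cands :: "('a \<Rightarrow> 'a \<Rightarrow> bool) \<Rightarrow> nat \<Rightarrow> nat \<Rightarrow> nat \<Rightarrow> 'a set \<Rightarrow> 'a set" where
  "greedy_cands E K m 0 Y = {}"
| "greedy_cands E K m (Suc k) Y =
     (if card Y < m then {} else \<Union>w\<in>heavy E K Y. insert w (greedy_cands E K m k (Y - cnbh E w)))"

lemma heavy_in_cover:
  assumes "finite D" "card D \<le> K" and cover: "Y \<subseteq> (\<Union>u\<in>D. cnbh E u)" and "0 < card Y"
  shows "D \<inter> heavy E K Y \<noteq> {}"
proof
  assume "D \<inter> heavy E K Y = {}"
  then have light: "K * card (cnbh E w \<inter> Y) < card Y" if "w \<in> D" for w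
    using that unfolding heavy_def by (metis (mono_tags) disjoint_iff mem_Collect_eq not_le)
  have "Y = (\<Union>w\<in>D. cnbh E w \<inter> Y)" using cover by auto
  then have "card Y \<le> (\<Sum>w\<in>D. card (cnbh E w \<inter> Y))"
    using card_UN_le[OF \<open>finite D\<close>, of "\<lambda>w. cnbh E w \<inter> Y"] by simp
  then have "K * card Y \<le> (\<Sum>w\<in>D. K * card (cnbh E w \<inter> Y))"
    by (simp only: sum_distrib_left[symmetric] mult_le_mono2)
  also have "D \<noteq> {}" using cover \<open>0 < card Y\<close> by auto
  then have "(\<Sum>w\<in>D. K * card (cnbh E w \<inter> Y)) < card D * card Y"
    using sum_bounded_above_strict[of D, OF light] \<open>finite D\<close> by (simp add: card_gt_0_iff)
  also have "\<dots> \<le> K * card Y" using \<open>card D \<le> K\<close> by (rule mult_right_mono) simp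
  finally show False by simp
qed

lemma greedy_cands_hit_cover:
  assumes "finite Y" "finite D" "card D \<le> k" "k \<le> K" "0 < m"
    and "Y \<subseteq> (\<Union>u\<in>D. cnbh E u)" "B \<subseteq> Y" "m + k * t \<le> card B"
  shows "\<exists>w\<in>D \<inter> greedy_cands E K m k Y. t \<le> card (cnbh E w \<inter> B)"
  using assms
proof (induction k arbitrary: Y D B)
  case 0
  then show ?case by auto
next
  case (Suc k)
  have finite_B: "finite B" using Suc.prems(1,7) finite_subset by blast
  have "card B \<le> card Y" using Suc.prems(1,7) by (intro card_mono)
  then have large: "m \<le> card Y" using Suc.prems(8) by simp
  have "D \<inter> heavy E K Y \<noteq> {}"
    using Suc.prems large by (intro heavy_in_cover) simp_all
  then obtain w where heavy_w: "w \<in> D" "w \<in> heavy E K Y" by blast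
  then have cands_step:
    "insert w (greedy_cands E K m k (Y - cnbh E w)) \<subseteq> greedy_cands E K m (Suc k) Y"
    using large by auto
  show ?case
  proof (cases "t \<le> card (cnbh E w \<inter> B)")
    case True
    then show ?thesis using heavy_w cands_step by blast
  next
    case False
    let ?B = "B - cnbh E w"
    have "card B = card (cnbh E w \<inter> B) + card ?B"
      by (metis card_Int_Diff finite_B inf_commute)
    then have "m + k * t \<le> card ?B" using False Suc.prems(8) by simp
    then have "\<exists>v\<in>(D - {w}) \<inter> greedy_cands E K m k (Y - cnbh E w). t \<le> card (cnbh E v \<inter> ?B)"
      using Suc.prems heavy_w(1) by (intro Suc.IH) auto
    then obtain v where hit: "v \<in> D \<inter> greedy_cands E K m (Suc k) Y" "t \<le> card (cnbh E v \<inter> ?B)"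
      using cands_step by blast
    moreover have "card (cnbh E v \<inter> ?B) \<le> card (cnbh E v \<inter> B)"
      using finite_B by (intro card_mono) auto
    ultimately show ?thesis using le_trans by blast
  qed
qed

lemma greedy_cands_cong:
  "(\<And>w. cnbh E w \<inter> Y = cnbh E' w \<inter> Y) \<Longrightarrow> greedy_cands E K m k Y = greedy_cands E' K m k Y"
proof (induction k arbitrary: Y)
  case (Suc k)
  have "heavy E K Y = heavy E' K Y" by (simp add: heavy_def Suc.prems)
  moreover have "greedy_cands E K m k (Y - cnbh E w) = greedy_cands E' K m k (Y - cnbh E' w)" for w
  proof -
    have "Y - cnbh E w = Y - cnbh E' w" using Suc.prems[of w] by blast
    moreover have "greedy_cands E K m k (Y - cnbh E w) = greedy_cands E' K m k (Y - cnbh E w)"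
      using Suc.prems by (intro Suc.IH) blast
    ultimately show ?thesis by simp
  qed
  ultimately show ?case by simp
qed simp

context fin_graph
begin

lemma heavy_subset:
  assumes "Y \<subseteq> V" "0 < card Y"
  shows "heavy E K Y \<subseteq> V"
proof
  fix w assume "w \<in> heavy E K Y"
  then have "cnbh E w \<inter> Y \<noteq> {}" using \<open>0 < card Y\<close> by (auto simp: heavy_def)
  then show "w \<in> V" using \<open>Y \<subseteq> V\<close> cnbh_outside[of w] by (cases "w \<in> V") auto
qed

lemma greedy_cands_subset: "Y \<subseteq> V \<Longrightarrow> 0 < m \<Longrightarrow> greedy_cands E K m k Y \<subseteq> V"
proof (induction k arbitrary: Y)
  case (Suc k)
  show ?case
  proof (cases "card Y < m")
    case False
    then have "heavy E K Y \<subseteq> V" using Suc.prems by (intro heavy_subset) simp_all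
    moreover have "greedy_cands E K m k (Y - cnbh E w) \<subseteq> V" for w
      using Suc.prems by (intro Suc.IH) auto
    ultimately show ?thesis using False by auto
  qed simp
qed simp

lemma card_greedy_cands_less:
  assumes few: "\<And>Y. Y \<subseteq> V \<Longrightarrow> m \<le> card Y \<Longrightarrow> card (heavy E K Y) \<le> h" and "0 < m"
  shows "Y \<subseteq> V \<Longrightarrow> card (greedy_cands E K m k Y) < (1 + h) ^ k"
proof (induction k arbitrary: Y)
  case (Suc k)
  let ?next = "\<lambda>w. insert w (greedy_cands E K m k (Y - cnbh E w))"
  show ?case
  proof (cases "card Y < m")
    case False
    have finite_heavy: "finite (heavy E K Y)"
      using False \<open>0 < m\<close> Suc.prems by (intro finite_subset_V heavy_subset) simp_all
    have "card (?next w) \<le> (1 + h) ^ k" for w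
    proof (rule card_insert_le_m1)
      have "card (greedy_cands E K m k (Y - cnbh E w)) < (1 + h) ^ k"
        using Suc.prems by (intro Suc.IH) auto
      then show "card (greedy_cands E K m k (Y - cnbh E w)) \<le> (1 + h) ^ k - 1" by simp
    qed simp
    then have "card (\<Union>w\<in>heavy E K Y. ?next w) \<le> card (heavy E K Y) * (1 + h) ^ k"
      by (rule card_UN_le_mult[OF finite_heavy])
    also have "\<dots> \<le> h * (1 + h) ^ k"
      using few[OF Suc.prems] False by (intro mult_right_mono) simp_all
    also have "\<dots> < (1 + h) ^ Suc k" by simp
    finally show ?thesis using False by simp
  qed simp
qed simp

end

lemma (in nabla1_graph) card_heavy_le:
  assumes Y_subset: "Y \<subseteq> V" and large: "K * (2 * d + 1) * (2 * d * K + 1) < card Y"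
  shows "card (heavy E K Y) \<le> 2 * d * K"
proof (rule ccontr)
  let ?n = "2 * d * K + 1"
  assume "\<not> card (heavy E K Y) \<le> 2 * d * K"
  then have "?n \<le> card (heavy E K Y)" by simp
  then obtain Z where heavy_Z: "Z \<subseteq> heavy E K Y" "card Z = ?n"
    by (meson obtain_subset_with_card_n)
  have Z_subset: "Z \<subseteq> V" using heavy_Z(1) heavy_subset[OF Y_subset] large by fastforce
  have "?n * card Y = (\<Sum>z\<in>Z. card Y)" by (simp only: sum_constant heavy_Z(2) of_nat_id)
  also have "\<dots> \<le> (\<Sum>z\<in>Z. K * card (cnbh E z \<inter> Y))"
    using heavy_Z(1) by (intro sum_mono) (auto simp: heavy_def)
  also have "\<dots> = K * (\<Sum>z\<in>Z. card (cnbh E z \<inter> Y))" by (simp only: sum_distrib_left)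
  also have "\<dots> \<le> K * ((2 * d + 1) * ?n + 2 * d * card Y)"
    using sum_card_cnbh_le[OF Z_subset Y_subset] unfolding heavy_Z(2) by (rule mult_left_mono) simp
  also have "\<dots> = K * (2 * d + 1) * ?n + (2 * d * K) * card Y" by (simp only: algebra_simps)
  finally have "card Y \<le> K * (2 * d + 1) * ?n" by (simp only: distrib_right mult_1)
  then show False using large by simp
qed

section \<open>Chains of candidates\<close>

inductive chain :: "('a \<Rightarrow> 'a set) \<Rightarrow> 'a set \<Rightarrow> 'a \<Rightarrow> bool" for C where
  single: "chain C {x} x"
| extend: "chain C X x \<Longrightarrow> w \<in> C x \<Longrightarrow> w \<notin> X \<Longrightarrow> chain C (insert w X) w"

lemma chain_finite: "chain C X x \<Longrightarrow> finite X"
  by (induction rule: chain.induct) auto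

lemma chain_end: "chain C X x \<Longrightarrow> x \<in> X"
  by (induction rule: chain.induct) auto

lemma chain_cong: "chain C X x \<Longrightarrow> (\<And>p. p \<in> X \<Longrightarrow> C p = C' p) \<Longrightarrow> chain C' X x"
proof (induction rule: chain.induct)
  case (single x)
  show ?case by (rule chain.single)
next
  case (extend X x w)
  have "w \<in> C' x" using extend.hyps(2) extend.prems chain_end[OF extend.hyps(1)] by blast
  then show ?case using extend by (intro chain.extend) auto
qed

primrec reach :: "('a \<Rightarrow> 'a set) \<Rightarrow> nat \<Rightarrow> 'a set \<Rightarrow> 'a set" where
  "reach C 0 A = A"
| "reach C (Suc i) A = reach C i A \<union> (\<Union>x\<in>reach C i A. C x)"

lemma reach_mono: "i \<le> j \<Longrightarrow> reach C i A \<subseteq> reach C j A"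
  by (rule lift_Suc_mono_le[where f = "\<lambda>i. reach C i A"]) auto

lemma chain_end_reach: "chain C X x \<Longrightarrow> X \<inter> A \<noteq> {} \<Longrightarrow> x \<in> reach C (card X) A"
proof (induction rule: chain.induct)
  case (single x)
  then show ?case by auto
next
  case (extend X x w)
  have card: "card (insert w X) = Suc (card X)"
    using extend.hyps(3) chain_finite[OF extend.hyps(1)] by simp
  show ?case
  proof (cases "w \<in> A")
    case True
    then show ?thesis using reach_mono[of 0 "card (insert w X)" C A] by auto
  next
    case False
    then have "x \<in> reach C (card X) A" using extend by auto
    then show ?thesis using extend.hyps unfolding card by auto
  qed
qed

lemma reach_subset: "(\<And>x. x \<in> V \<Longrightarrow> C x \<subseteq> V) \<Longrightarrow> A \<subseteq> V \<Longrightarrow> reach C i A \<subseteq> V"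
  by (induction i) auto

lemma card_reach_le:
  assumes "finite V" "A \<subseteq> V" and closed: "\<And>x. x \<in> V \<Longrightarrow> C x \<subseteq> V"
    and few: "\<And>x. x \<in> V \<Longrightarrow> card (C x) < q"
  shows "card (reach C i A) \<le> q ^ i * card A"
proof (induction i)
  case (Suc i)
  let ?R = "reach C i A"
  have R_subset: "?R \<subseteq> V" using closed \<open>A \<subseteq> V\<close> by (rule reach_subset)
  have "card (C x) \<le> q - 1" if "x \<in> ?R" for x
    using few[of x] R_subset that by fastforce
  then have step: "card (\<Union>x\<in>?R. C x) \<le> card ?R * (q - 1)"
    using finite_subset[OF R_subset \<open>finite V\<close>] by (intro card_UN_le_mult)
  have "card (reach C (Suc i) A) \<le> card ?R + card (\<Union>x\<in>?R. C x)"
    by (simp add: card_Un_le)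
  also have "\<dots> \<le> q * card ?R"
  proof (cases "?R = {}")
    case False
    then have "0 < q" using few R_subset by fastforce
    then have "q * card ?R = card ?R + card ?R * (q - 1)" by (cases q) simp_all
    then show ?thesis using step by simp
  qed simp
  also have "\<dots> \<le> q ^ Suc i * card A" using Suc.IH by (simp add: mult.assoc)
  finally show ?case .
qed simp

definition thick_ends ::
  "('a \<Rightarrow> 'a \<Rightarrow> bool) \<Rightarrow> ('a \<Rightarrow> 'a set) \<Rightarrow> nat \<Rightarrow> nat \<Rightarrow> 'a set \<Rightarrow> 'a set" where
  "thick_ends E C n t U =
     {x. \<exists>X. chain C X x \<and> card X = n \<and> t \<le> card (U \<inter> common_cnbh E X)}"

lemma thick_ends_subset_reach:
  assumes hit: "\<And>x B. x \<notin> A \<Longrightarrow> B \<subseteq> cnbh E x \<Longrightarrow> t \<le> card B \<Longrightarrow> \<exists>w\<in>A \<inter> C x. s \<le> card (cnbh E w \<inter> B)"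
    and thin: "\<And>X x. chain C X x \<Longrightarrow> card X = Suc n \<Longrightarrow> card (U \<inter> common_cnbh E X) < s"
  shows "thick_ends E C n t U \<subseteq> reach C n A"
proof
  fix x assume "x \<in> thick_ends E C n t U"
  then obtain X where thick_X: "chain C X x" "card X = n" "t \<le> card (U \<inter> common_cnbh E X)"
    unfolding thick_ends_def by blast
  let ?B = "U \<inter> common_cnbh E X"
  have "X \<inter> A \<noteq> {}"
  proof (cases "x \<in> A")
    case True
    then show ?thesis using chain_end[OF thick_X(1)] by blast
  next
    case False
    have "?B \<subseteq> cnbh E x" using common_cnbh_subset[OF chain_end[OF thick_X(1)]] by blast
    then obtain w where hit_w: "w \<in> A" "w \<in> C x" "s \<le> card (cnbh E w \<inter> ?B)"
      using hit[OF False _ thick_X(3)] by blast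
    have "w \<in> X"
    proof (rule ccontr)
      assume "w \<notin> X"
      then have "card (insert w X) = Suc n" using thick_X(2) chain_finite[OF thick_X(1)] by simp
      with chain.extend[OF thick_X(1) hit_w(2) \<open>w \<notin> X\<close>]
      have "card (U \<inter> common_cnbh E (insert w X)) < s"
        by (rule thin)
      then show False using hit_w(3) by (simp add: common_cnbh_insert inf_left_commute)
    qed
    then show ?thesis using hit_w(1) by blast
  qed
  then show "x \<in> reach C n A" using chain_end_reach[OF thick_X(1)] thick_X(2) by blast
qed

lemma (in fin_graph) thick_ends_subset:
  assumes "2 \<le> t"
  shows "thick_ends E C n t U \<subseteq> V"
proof
  fix x assume "x \<in> thick_ends E C n t U"
  then obtain X where thick_X: "chain C X x" "t \<le> card (U \<inter> common_cnbh E X)"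
    unfolding thick_ends_def by blast
  have "card (U \<inter> common_cnbh E X) \<le> card (cnbh E x)"
    using finite_cnbh common_cnbh_subset[OF chain_end[OF thick_X(1)]] by (intro card_mono) auto
  then have "2 \<le> card (cnbh E x)" using thick_X(2) assms by linarith
  then show "x \<in> V" using cnbh_outside[of x] by (cases "x \<in> V") simp_all
qed

lemma (in fin_graph) thin_chain_after_removal:
  assumes chain_X: "chain C X x" "card X = n" and "0 < t"
  shows "card ((U - (\<Union>y\<in>thick_ends E C n t U. cnbh E y)) \<inter> common_cnbh E X) < t"
    (is "card (?U' \<inter> _) < t")
proof (rule ccontr)
  assume "\<not> card (?U' \<inter> common_cnbh E X) < t"
  moreover have common_subset: "common_cnbh E X \<subseteq> cnbh E x"
    by (rule common_cnbh_subset[OF chain_end[OF chain_X(1)]])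
  then have "card (?U' \<inter> common_cnbh E X) \<le> card (U \<inter> common_cnbh E X)"
    using finite_subset[OF common_subset finite_cnbh] by (intro card_mono) auto
  ultimately have "x \<in> thick_ends E C n t U"
    unfolding thick_ends_def using chain_X by auto
  then have "?U' \<inter> common_cnbh E X = {}" using common_subset by blast
  then show False using \<open>\<not> card (?U' \<inter> common_cnbh E X) < t\<close> \<open>0 < t\<close> by simp
qed

section \<open>The dominating set\<close>

definition stop_size :: "nat \<Rightarrow> nat" where
  "stop_size d = (2 * d + 1)\<^sup>2 * (2 * d * (2 * d + 1) + 1) + 1"

definition candidates :: "('a \<Rightarrow> 'a \<Rightarrow> bool) \<Rightarrow> nat \<Rightarrow> 'a \<Rightarrow> 'a set" where
  "candidates E d x = greedy_cands E (2 * d + 1) (stop_size d) (2 * d + 1) (cnbh E x)"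

definition candidates_bound :: "nat \<Rightarrow> nat" where
  "candidates_bound d = (1 + 2 * d * (2 * d + 1)) ^ (2 * d + 1)"

primrec thickness :: "nat \<Rightarrow> nat \<Rightarrow> nat" where
  "thickness d 0 = (2 * d + 1)\<^sup>2 + 1"
| "thickness d (Suc j) = stop_size d + (2 * d + 1) * thickness d j"

definition stage :: "('a \<Rightarrow> 'a \<Rightarrow> bool) \<Rightarrow> nat \<Rightarrow> nat \<Rightarrow> 'a set \<Rightarrow> 'a set" where
  "stage E d j U = thick_ends E (candidates E d) (2 * d - j) (thickness d (Suc j)) U"

primrec undominated :: "('a \<Rightarrow> 'a \<Rightarrow> bool) \<Rightarrow> nat \<Rightarrow> nat \<Rightarrow> 'a set" where
  "undominated E d 0 = UNIV"
| "undominated E d (Suc j) = undominated E d j - (\<Union>x\<in>stage E d j (undominated E d j). cnbh E x)"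

abbreviation selected :: "('a \<Rightarrow> 'a \<Rightarrow> bool) \<Rightarrow> nat \<Rightarrow> nat \<Rightarrow> 'a set" where
  "selected E d j \<equiv> stage E d j (undominated E d j)"

definition local_dominators :: "('a \<Rightarrow> 'a \<Rightarrow> bool) \<Rightarrow> nat \<Rightarrow> 'a set" where
  "local_dominators E d = (\<Union>j<2 * d. selected E d j) \<union> undominated E d (2 * d)"

definition approx_factor :: "nat \<Rightarrow> nat" where
  "approx_factor d = 2 * d * (candidates_bound d ^ (2 * d) * (2 * d + 1)) + thickness d (2 * d)"

lemma thickness_ge_2: "2 \<le> thickness d j"
proof (induction j)
  case 0
  then show ?case by (simp add: power2_eq_square)
next
  case (Suc j)
  then have "2 \<le> 1 * thickness d j" by simp
  also have "\<dots> \<le> (2 * d + 1) * thickness d j" by (intro mult_right_mono) auto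
  finally show ?case by simp
qed

lemma thickness_pos: "0 < thickness d j"
  using thickness_ge_2[of d j] by linarith

lemma undominated_eq: "undominated E d i = - (\<Union>j<i. \<Union>x\<in>selected E d j. cnbh E x)"
  by (induction i) (auto simp: lessThan_Suc)

context fin_graph
begin

lemma stage_subset: "stage E d j U \<subseteq> V"
  unfolding stage_def by (intro thick_ends_subset thickness_ge_2)

lemma dominating_local_dominators: "dominating V E (V \<inter> local_dominators E d)"
  unfolding dominating_def
proof (intro conjI ballI)
  fix v assume "v \<in> V"
  show "v \<in> V \<inter> local_dominators E d \<or> (\<exists>u\<in>V \<inter> local_dominators E d. E v u)"
  proof (cases "v \<in> undominated E d (2 * d)")
    case True
    then show ?thesis using \<open>v \<in> V\<close> by (simp add: local_dominators_def)
  next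
    case False
    then obtain j x where selected: "j < 2 * d" "x \<in> selected E d j" "v \<in> cnbh E x"
      unfolding undominated_eq[of E d "2 * d"] by blast
    then have "x \<in> V \<inter> local_dominators E d"
      using stage_subset by (auto simp: local_dominators_def)
    moreover have "x = v \<or> E v x" using selected(3) symp_E by (auto simp: cnbh_def dest: sympD)
    ultimately show ?thesis by blast
  qed
qed simp

lemma candidates_subset: "x \<in> V \<Longrightarrow> candidates E d x \<subseteq> V"
  unfolding candidates_def by (intro greedy_cands_subset cnbh_subset) (simp_all add: stop_size_def)

lemma candidates_hit_dominators:
  assumes dominates: "dominating V E D" and covered: "x \<notin> D \<union> scattered V E (2 * d + 1) D"
    and large_B: "B \<subseteq> cnbh E x" "thickness d (Suc j) \<le> card B"
  shows "\<exists>w\<in>D \<inter> candidates E d x. thickness d j \<le> card (cnbh E w \<inter> B)"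
proof -
  have "2 \<le> card (cnbh E x)"
    using thickness_ge_2[of d "Suc j"] large_B card_mono[OF finite_cnbh large_B(1)] by linarith
  then have "x \<in> V" using cnbh_outside[of x] by (cases "x \<in> V") simp_all
  then obtain D' where cover: "D' \<subseteq> D" "card D' \<le> 2 * d + 1" "cnbh E x \<subseteq> (\<Union>u\<in>D'. cnbh E u)"
    using covered unfolding scattered_def by blast
  have "finite D'" using cover(1) finite_dominating[OF dominates] by (rule finite_subset)
  then have "\<exists>w\<in>D' \<inter> candidates E d x. thickness d j \<le> card (cnbh E w \<inter> B)"
    unfolding candidates_def using cover large_B
    by (intro greedy_cands_hit_cover finite_cnbh) (simp_all add: stop_size_def)
  then show ?thesis using cover(1) by blast
qed

end

context nabla1_graph
begin

lemma card_candidates_less: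
  assumes "x \<in> V"
  shows "card (candidates E d x) < candidates_bound d"
  unfolding candidates_def candidates_bound_def
proof (rule card_greedy_cands_less)
  fix Y assume "Y \<subseteq> V" "stop_size d \<le> card Y"
  then show "card (heavy E (2 * d + 1) Y) \<le> 2 * d * (2 * d + 1)"
    by (intro card_heavy_le) (simp_all add: stop_size_def power2_eq_square)
qed (simp_all add: stop_size_def cnbh_subset assms)

lemma card_undominated_common_cnbh_less:
  assumes "j \<le> 2 * d" and chain_X: "chain (candidates E d) X x" "card X = 2 * d + 1 - j"
  shows "card (undominated E d j \<inter> common_cnbh E X) < thickness d j"
proof (cases j)
  case 0
  then have "card (common_cnbh E X) \<le> (2 * d + 1)\<^sup>2"
    using card_common_cnbh_le[of X] chain_X(2) by (simp add: power2_eq_square)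
  then show ?thesis using 0 by simp
next
  case (Suc i)
  then have "card X = 2 * d - i" using chain_X(2) by simp
  then show ?thesis
    unfolding Suc undominated.simps stage_def
    by (rule thin_chain_after_removal[OF chain_X(1) _ thickness_pos])
qed

lemma selected_subset_reach:
  assumes dominates: "dominating V E D" and stage_index: "j < 2 * d"
  shows "selected E d j
    \<subseteq> reach (candidates E d) (2 * d - j) (D \<union> scattered V E (2 * d + 1) D)"
  unfolding stage_def
proof (rule thick_ends_subset_reach[where s = "thickness d j"])
  fix x B
  assume "x \<notin> D \<union> scattered V E (2 * d + 1) D" "B \<subseteq> cnbh E x" "thickness d (Suc j) \<le> card B"
  then show "\<exists>w\<in>(D \<union> scattered V E (2 * d + 1) D) \<inter> candidates E d x.
      thickness d j \<le> card (cnbh E w \<inter> B)"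
    using candidates_hit_dominators[OF dominates] by blast
next
  fix X x assume "chain (candidates E d) X x" "card X = Suc (2 * d - j)"
  then show "card (undominated E d j \<inter> common_cnbh E X) < thickness d j"
    using stage_index by (intro card_undominated_common_cnbh_less) simp_all
qed

lemma card_selected_le:
  assumes dominates: "dominating V E D" and stage_index: "j < 2 * d"
  shows "card (selected E d j) \<le> candidates_bound d ^ (2 * d) * ((2 * d + 1) * card D)"
proof -
  let ?A = "D \<union> scattered V E (2 * d + 1) D"
  have A_subset: "?A \<subseteq> V" using dominates by (auto simp: dominating_def scattered_def)
  have "selected E d j \<subseteq> reach (candidates E d) (2 * d) ?A"
    using selected_subset_reach[OF dominates stage_index] reach_mono[of "2 * d - j" "2 * d"]
    by fastforce
  moreover have "reach (candidates E d) (2 * d) ?A \<subseteq> V"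
    using candidates_subset A_subset by (rule reach_subset)
  ultimately have "card (selected E d j) \<le> card (reach (candidates E d) (2 * d) ?A)"
    by (intro card_mono finite_subset_V)
  also have "\<dots> \<le> candidates_bound d ^ (2 * d) * card ?A"
    using finite_subset_V[OF subset_refl] A_subset candidates_subset card_candidates_less
    by (rule card_reach_le)
  also have "\<dots> \<le> candidates_bound d ^ (2 * d) * ((2 * d + 1) * card D)"
    by (intro mult_left_mono card_Un_scattered_le[OF dominates]) simp
  finally show ?thesis .
qed

lemma card_undominated_le:
  assumes "dominating V E D"
  shows "card (V \<inter> undominated E d (2 * d)) \<le> card D * thickness d (2 * d)"
  using assms
proof (rule card_le_by_domination)
  fix u
  have "card (undominated E d (2 * d) \<inter> common_cnbh E {u}) < thickness d (2 * d)"
    by (rule card_undominated_common_cnbh_less[OF _ chain.single]) simp_all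
  then show "card (undominated E d (2 * d) \<inter> cnbh E u) \<le> thickness d (2 * d)"
    by (simp add: common_cnbh_def)
qed

lemma card_local_dominators_le:
  assumes dominates: "dominating V E D"
  shows "card (V \<inter> local_dominators E d) \<le> approx_factor d * card D"
proof -
  let ?S = "\<Union>j<2 * d. selected E d j" and ?U = "V \<inter> undominated E d (2 * d)"
  have "V \<inter> local_dominators E d \<subseteq> ?S \<union> ?U"
    by (auto simp: local_dominators_def)
  moreover have "?S \<union> ?U \<subseteq> V" using stage_subset by blast
  ultimately have "card (V \<inter> local_dominators E d) \<le> card (?S \<union> ?U)"
    by (intro card_mono finite_subset_V)
  also have "\<dots> \<le> card ?S + card ?U" by (rule card_Un_le)
  also have "card ?S \<le> card {..<2 * d} * (candidates_bound d ^ (2 * d) * ((2 * d + 1) * card D))"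
    using card_selected_le[OF dominates] by (intro card_UN_le_mult) simp_all
  also have "card ?U \<le> card D * thickness d (2 * d)" by (rule card_undominated_le[OF dominates])
  finally show ?thesis by (simp add: approx_factor_def algebra_simps)
qed

end

section \<open>Locality\<close>

primrec agree :: "nat \<Rightarrow> ('a \<Rightarrow> 'a \<Rightarrow> bool) \<Rightarrow> ('a \<Rightarrow> 'a \<Rightarrow> bool) \<Rightarrow> 'a \<Rightarrow> bool" where
  "agree 0 E E' v \<longleftrightarrow> True"
| "agree (Suc n) E E' v \<longleftrightarrow> cnbh E v = cnbh E' v \<and> (\<forall>u\<in>cnbh E v. agree n E E' u)"

lemma agree_sym: "agree n E E' v \<Longrightarrow> agree n E' E v"
  by (induction n arbitrary: v) auto

lemma agree_mono: "agree n E E' v \<Longrightarrow> m \<le> n \<Longrightarrow> agree m E E' v"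
proof (induction n arbitrary: m v)
  case (Suc n)
  then show ?case by (cases m) auto
qed simp

lemma agree_cnbh: "agree n E E' v \<Longrightarrow> 0 < n \<Longrightarrow> cnbh E v = cnbh E' v"
  by (cases n) simp_all

lemma agree_neighbour: "agree n E E' v \<Longrightarrow> m < n \<Longrightarrow> u \<in> cnbh E v \<Longrightarrow> agree m E E' u"
  using agree_mono[of "n - 1" E E' u m] by (cases n) simp_all

definition is_local :: "nat \<Rightarrow> (('a \<Rightarrow> 'a \<Rightarrow> bool) \<Rightarrow> 'a \<Rightarrow> 'b) \<Rightarrow> bool" where
  "is_local r f \<longleftrightarrow>
     (\<forall>E E' v. symp E \<longrightarrow> symp E' \<longrightarrow> agree r E E' v \<longrightarrow> f E v = f E' v)"

lemma is_localD: "is_local r f \<Longrightarrow> symp E \<Longrightarrow> symp E' \<Longrightarrow> agree r E E' v \<Longrightarrow> f E v = f E' v"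
  by (simp add: is_local_def)

lemma is_local_predI:
  assumes "\<And>E E' v. symp E \<Longrightarrow> symp E' \<Longrightarrow> agree r E E' v \<Longrightarrow> P E v \<Longrightarrow> P E' v"
  shows "is_local r P"
  unfolding is_local_def
proof (intro allI impI iffI)
  fix E E' :: "'a \<Rightarrow> 'a \<Rightarrow> bool" and v
  assume symps: "symp E" "symp E'" and agreement: "agree r E E' v"
  show "P E' v" if "P E v" using symps agreement that by (rule assms)
  show "P E v" if "P E' v" using symps(2,1) agree_sym[OF agreement] that by (rule assms)
qed

lemma is_local_candidates: "is_local 2 (\<lambda>E. candidates E d)"
  unfolding is_local_def
proof (intro allI impI)
  fix E E' :: "'a \<Rightarrow> 'a \<Rightarrow> bool" and x
  assume symps: "symp E" "symp E'" and agreement: "agree 2 E E' x"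
  have "cnbh E w \<inter> cnbh E x = cnbh E' w \<inter> cnbh E x" for w
  proof -
    have "y \<in> cnbh E w \<longleftrightarrow> y \<in> cnbh E' w" if "y \<in> cnbh E x" for y
    proof -
      have "cnbh E y = cnbh E' y"
        using agree_neighbour[OF agreement _ that, of 1] by (intro agree_cnbh[of 1]) simp_all
      then show ?thesis
        using cnbh_commute[OF symps(1), of y w] cnbh_commute[OF symps(2), of y w] by simp
    qed
    then show ?thesis by blast
  qed
  then have "candidates E d x = greedy_cands E' (2 * d + 1) (stop_size d) (2 * d + 1) (cnbh E x)"
    unfolding candidates_def by (rule greedy_cands_cong)
  also have "cnbh E x = cnbh E' x" using agreement by (rule agree_cnbh) simp
  finally show "candidates E d x = candidates E' d x" unfolding candidates_def .
qed

text \<open>The members of a thick chain have a common neighbour, so that they all lie within distance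
  two of its last vertex.\<close>

lemma is_local_thick_ends:
  assumes local_C: "is_local a C" and local_U: "is_local b (\<lambda>E v. v \<in> U E)" and "0 < a" "0 < t"
    and radius: "a + 2 \<le> r" "b < r"
  shows "is_local r (\<lambda>E x. x \<in> thick_ends E (C E) n t (U E))"
proof (rule is_local_predI)
  fix E E' x
  assume symps: "symp E" "symp E'" and agreement: "agree r E E' x"
    and "x \<in> thick_ends E (C E) n t (U E)"
  then obtain X where thick_X: "chain (C E) X x" "card X = n" "t \<le> card (U E \<inter> common_cnbh E X)"
    unfolding thick_ends_def by blast
  have x_in_X: "x \<in> X" by (rule chain_end[OF thick_X(1)])
  obtain y where common_y: "y \<in> common_cnbh E X" using thick_X(3) \<open>0 < t\<close> by fastforce
  have near: "agree a E E' p" if "p \<in> X" for p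
  proof (rule agree_neighbour)
    show "agree (a + 1) E E' y"
      using agreement by (rule agree_neighbour)
        (use radius(1) common_y common_cnbh_subset[OF x_in_X] in auto)
    show "p \<in> cnbh E y"
      using common_y common_cnbh_subset[OF that] cnbh_commute[OF symps(1)] by blast
  qed simp
  have "common_cnbh E X = common_cnbh E' X"
    unfolding common_cnbh_def using agree_cnbh[OF near \<open>0 < a\<close>] by simp
  moreover have "v \<in> U E \<longleftrightarrow> v \<in> U E'" if "v \<in> cnbh E x" for v
    using is_localD[OF local_U symps agree_neighbour[OF agreement radius(2) that]] .
  ultimately have "U E \<inter> common_cnbh E X = U E' \<inter> common_cnbh E' X"
    using common_cnbh_subset[OF x_in_X, of E] by blast
  moreover have "chain (C E') X x"
    using thick_X(1) is_localD[OF local_C symps near] by (rule chain_cong)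
  ultimately show "x \<in> thick_ends E' (C E') n t (U E')"
    unfolding thick_ends_def using thick_X by auto
qed

lemma is_local_stage:
  assumes "is_local b (\<lambda>E v. v \<in> U E)" "4 \<le> r" "b < r"
  shows "is_local r (\<lambda>E x. x \<in> stage E d j (U E))"
  unfolding stage_def
  using assms by (intro is_local_thick_ends[OF is_local_candidates _ _ thickness_pos]) simp_all

lemma is_local_undominated: "is_local (2 * j + 3) (\<lambda>E v. v \<in> undominated E d j)"
proof (induction j)
  case 0
  then show ?case by (simp add: is_local_def)
next
  case (Suc j)
  have local_selected: "is_local (2 * j + 4) (\<lambda>(E :: 'a \<Rightarrow> 'a \<Rightarrow> bool) x. x \<in> selected E d j)"
    by (rule is_local_stage[OF Suc.IH]) simp_all
  show ?case
  proof (rule is_local_predI)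
    fix E E' :: "'a \<Rightarrow> 'a \<Rightarrow> bool" and y
    assume symps: "symp E" "symp E'" and agreement: "agree (2 * Suc j + 3) E E' y"
      and undominated_y: "y \<in> undominated E d (Suc j)"
    have "y \<in> undominated E' d j"
      using is_localD[OF Suc.IH symps agree_mono[OF agreement]] undominated_y by simp
    moreover have "y \<notin> cnbh E' x" if selected: "x \<in> selected E' d j" for x
    proof
      assume "y \<in> cnbh E' x"
      then have near: "x \<in> cnbh E y"
        using cnbh_commute[OF symps(2)] agree_cnbh[OF agreement] by fastforce
      then have "x \<in> selected E d j"
        using is_localD[OF local_selected symps agree_neighbour[OF agreement _ near]] selected
        by simp
      then show False using undominated_y near cnbh_commute[OF symps(1)] by auto
    qed
    ultimately show "y \<in> undominated E' d (Suc j)" by simp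
  qed
qed

lemma is_local_selected:
  assumes "2 * j + 4 \<le> r"
  shows "is_local r (\<lambda>E x. x \<in> selected E d j)"
  using assms by (intro is_local_stage[OF is_local_undominated]) simp_all

lemma is_local_local_dominators: "is_local (4 * d + 3) (\<lambda>E v. v \<in> local_dominators E d)"
  unfolding is_local_def
proof (intro allI impI)
  fix E E' :: "'a \<Rightarrow> 'a \<Rightarrow> bool" and v
  assume symps: "symp E" "symp E'" and agreement: "agree (4 * d + 3) E E' v"
  have "v \<in> selected E d j \<longleftrightarrow> v \<in> selected E' d j" if "j < 2 * d" for j
    using is_local_selected symps agreement by (rule is_localD) (use that in simp)
  moreover have "v \<in> undominated E d (2 * d) \<longleftrightarrow> v \<in> undominated E' d (2 * d)"
    using is_local_undominated symps by (rule is_localD) (rule agree_mono[OF agreement], simp)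
  ultimately show "v \<in> local_dominators E d \<longleftrightarrow> v \<in> local_dominators E' d"
    unfolding local_dominators_def by blast
qed

section \<open>Full-information gathering\<close>

definition encode_view :: "nat \<Rightarrow> (nat \<times> nat) set \<Rightarrow> nat" where
  "encode_view v F = prod_encode (v, set_encode (prod_encode ` F))"

definition id_of :: "nat \<Rightarrow> nat" where
  "id_of s = fst (prod_decode s)"

definition edges_of :: "nat \<Rightarrow> (nat \<times> nat) set" where
  "edges_of s = prod_decode ` set_decode (snd (prod_decode s))"

definition gather :: "nat \<Rightarrow> nat set \<Rightarrow> nat" where
  "gather s M = encode_view (id_of s)
     (edges_of s \<union> (\<Union>m\<in>M. insert (id_of s, id_of m) (insert (id_of m, id_of s) (edges_of m))))"

primrec known :: "('a \<Rightarrow> 'a \<Rightarrow> bool) \<Rightarrow> nat \<Rightarrow> 'a \<Rightarrow> ('a \<times> 'a) set" where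
  "known E 0 v = {}"
| "known E (Suc t) v =
     known E t v \<union> (\<Union>u\<in>{u. E v u}. insert (v, u) (insert (u, v) (known E t u)))"

lemma id_of_encode_view [simp]: "id_of (encode_view v F) = v"
  by (simp add: id_of_def encode_view_def)

lemma edges_of_encode_view [simp]: "finite F \<Longrightarrow> edges_of (encode_view v F) = F"
  by (simp add: edges_of_def encode_view_def image_image)

lemma known_subset: "symp E \<Longrightarrow> known E t v \<subseteq> {(a, b). E a b}"
  by (induction t arbitrary: v) (auto dest: sympD)

lemma known_sym: "(a, b) \<in> known E t v \<Longrightarrow> (b, a) \<in> known E t v"
  by (induction t arbitrary: v) auto

lemma agree_known:
  assumes edges: "F \<subseteq> {(a, b). E a b}"
  shows "known E n v \<subseteq> F \<Longrightarrow> agree n E (\<lambda>a b. (a, b) \<in> F) v"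
proof (induction n arbitrary: v)
  case (Suc n)
  have "(v, u) \<in> F \<longleftrightarrow> E v u" for u using Suc.prems edges by auto
  then have "cnbh E v = cnbh (\<lambda>a b. (a, b) \<in> F) v" by (simp add: cnbh_def)
  moreover have "agree n E (\<lambda>a b. (a, b) \<in> F) u" if "u \<in> cnbh E v" for u
    using that Suc.prems by (intro Suc.IH) (auto simp: cnbh_def)
  ultimately show ?case by simp
qed simp

lemma is_local_known:
  assumes "is_local r P" "symp E"
  shows "P (\<lambda>a b. (a, b) \<in> known E r v) v = P E v"
proof (rule is_localD[OF assms, symmetric])
  show "symp (\<lambda>a b. (a, b) \<in> known E r v)" by (rule sympI) (rule known_sym)
  show "agree r E (\<lambda>a b. (a, b) \<in> known E r v) v"
    by (intro agree_known known_subset assms(2) subset_refl)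
qed

context fin_graph
begin

lemma finite_known: "finite (known E t v)"
proof (rule finite_subset)
  show "known E t v \<subseteq> V \<times> V" using known_subset[OF symp_E] adjD by fast
  show "finite (V \<times> V)" by (simp add: finite_subset_V)
qed

lemma local_state_gather:
  "local_state (\<lambda>v. encode_view v {}) (\<lambda>s. s) gather V E t v = encode_view v (known E t v)"
proof (induction t arbitrary: v)
  case (Suc t)
  have "{u \<in> V. E v u} = {u. E v u}" using adjD by blast
  then show ?case
    by (simp add: Suc) (simp add: gather_def finite_known)
qed simp

end

lemma is_local_imp_local_output:
  fixes P :: "(nat \<Rightarrow> nat \<Rightarrow> bool) \<Rightarrow> nat \<Rightarrow> bool"
  assumes "is_local r P"
  obtains init :: "nat \<Rightarrow> nat" and msg :: "nat \<Rightarrow> nat" and step :: "nat \<Rightarrow> nat set \<Rightarrow> nat"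
    and out :: "nat \<Rightarrow> bool"
  where "\<And>V E. graph V E \<Longrightarrow> local_output init msg step out r V E = {v \<in> V. P E v}"
proof
  fix V E assume "graph V E"
  then interpret fin_graph V E by unfold_locales
  show "local_output (\<lambda>v. encode_view v {}) (\<lambda>s. s) gather
      (\<lambda>s. P (\<lambda>a b. (a, b) \<in> edges_of s) (id_of s)) r V E = {v \<in> V. P E v}"
    using is_local_known[OF assms symp_E]
    by (simp add: local_output_def local_state_gather finite_known)
qed

theorem theorem1:
  fixes d :: nat
  assumes "d > 0"
  shows "\<exists>(r::nat) (c::real) (init :: nat \<Rightarrow> nat) (msg :: nat \<Rightarrow> nat)
            (step :: nat \<Rightarrow> nat set \<Rightarrow> nat) (out :: nat \<Rightarrow> bool).
           \<forall>V E. graph V E \<and> nabla1_le V E d \<longrightarrow>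
             dominating V E (local_output init msg step out r V E) \<and>
             real (card (local_output init msg step out r V E))
               \<le> c * real (domination_number V E)"
proof -
  obtain init msg :: "nat \<Rightarrow> nat" and step :: "nat \<Rightarrow> nat set \<Rightarrow> nat" and out :: "nat \<Rightarrow> bool"
    where algorithm: "\<And>V E. graph V E \<Longrightarrow>
      local_output init msg step out (4 * d + 3) V E = {v \<in> V. v \<in> local_dominators E d}"
    by (rule is_local_imp_local_output[OF is_local_local_dominators[of d]]) (rule that)
  show ?thesis
  proof (intro exI allI impI)
    fix V E assume "graph V E \<and> nabla1_le V E d"
    then interpret nabla1_graph V E d by unfold_locales auto
    let ?O = "local_output init msg step out (4 * d + 3) V E"
    have output_eq: "?O = V \<inter> local_dominators E d" using algorithm[OF is_graph] by auto
    obtain D where minimum: "dominating V E D" "card D = domination_number V E"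
      by (rule domination_number_attained)
    have "real (card ?O) \<le> real (approx_factor d * domination_number V E)"
      using card_local_dominators_le[OF minimum(1)] unfolding output_eq minimum(2)
      by (simp only: of_nat_le_iff)
    then show "dominating V E ?O
        \<and> real (card ?O) \<le> real (approx_factor d) * real (domination_number V E)"
      using dominating_local_dominators output_eq by simp
  qed
qed

end
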